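(* Let $X_{\mathbb{R}}$ be a real vector space endowed with a norm $\|\cdot\|_{X_{\mathbb{R}}}$ and let $X$ be its algebraic complexification. Let $\nu$ be a monotone and shift-invariant norm on $\mathcal{C}([0,2\pi],\mathbb{R})$, and for $x\in X$ define $$\|x\|_X=\nu\big(\phi\mapsto\|\operatorname{Re}(e^{i\phi}x)\|_{X_{\mathbb{R}}}\big).$$ Then the function $\|\cdot\|_X:X\to\mathbb{R}$ is a norm on $X$. Suppose $\nu$ is normalized so that $\nu(\phi\mapsto|\cos\phi|)=1$. Then $\|x\|_X=\|x\|_{X_{\mathbb{R}}}$ for all $x\in X_{\mathbb{R}}$; in other words, $\|\cdot\|_X$ is an extension of $\|\cdot\|_{X_{\mathbb{R}}}$.
   Context: $X$ is the algebraic complexification of $X_{\mathbb{R}}$ if $X$ is a complex vector space and each $x\in X$ can be uniquely written as $x=x_1+ix_2$ with $x_1,x_2\in X_{\mathbb{R}}$; then $\operatorname{Re}x=x_1$. A norm on $X$ means a norm on the complex vector space $X$; in particular $\|\lambda x\|_X=|\lambda|\,\|x\|_X$ for all $\lambda\in\mathbb{C}$, $x\in X$. $\mathcal{C}([0,2\pi],\mathbb{R})$ is the set of continuous real-valued functions on $[0,2\pi]$. A norm $\nu$ on $\mathcal{C}([0,2\pi],\mathbb{R})$ is called monotone if $0\le f(t)\le g(t)$ for all $t\in[0,2\pi]$ implies $\nu(f)\le\nu(g)$. It is called shift-invariant if $\nu(f)=\nu(f_\psi)$ for all $f\in\mathcal{C}([0,2\pi],\mathbb{R})$ and all $\psi\in\mathbb{R}$,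 where $f_\psi(\phi)=f((\phi+\psi)\bmod 2\pi)$. For each $x\in X$ the function $\phi\mapsto\|\operatorname{Re}(e^{i\phi}x)\|_{X_{\mathbb{R}}}$, $\phi\in[0,2\pi]$, is continuous. *)

theory Defs
  imports Complex_Main "HOL-Library.Function_Algebras" "HOL-Library.Real_Mod"
begin

(* A norm on a subspace V (V = UNIV: on the whole space) of a vector space given by its
   scalar multiplication; used with scalars real and complex. *)
definition is_norm_on ::
    "('k::real_normed_field \<Rightarrow> 'v::ab_group_add \<Rightarrow> 'v) \<Rightarrow> 'v set \<Rightarrow> ('v \<Rightarrow> real) \<Rightarrow> bool" where
  "is_norm_on scale V N \<longleftrightarrow>
     (\<forall>x\<in>V. 0 \<le> N x) \<and>
     (\<forall>x\<in>V. N x = 0 \<longleftrightarrow> x = 0) \<and>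
     (\<forall>c. \<forall>x\<in>V. N (scale c x) = norm c * N x) \<and>
     (\<forall>x\<in>V. \<forall>y\<in>V. N (x + y) \<le> N x + N y)"

definition real_scale :: "(complex \<Rightarrow> 'a \<Rightarrow> 'a) \<Rightarrow> real \<Rightarrow> 'a \<Rightarrow> 'a" where
  "real_scale scale r x = scale (complex_of_real r) x"

(* The complex vector space (UNIV, scale) is the algebraic complexification of its real
   subspace XR. *)
definition algebraic_complexification ::
    "(complex \<Rightarrow> 'a::ab_group_add \<Rightarrow> 'a) \<Rightarrow> 'a set \<Rightarrow> bool" where
  "algebraic_complexification scale XR \<longleftrightarrow>
     vector_space scale \<and>
     module.subspace (real_scale scale) XR \<and>
     (\<forall>x. \<exists>!p. fst p \<in> XR \<and> snd p \<in> XR \<and> x = fst p + scale \<i> (snd p))"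

definition real_part ::
    "(complex \<Rightarrow> 'a::ab_group_add \<Rightarrow> 'a) \<Rightarrow> 'a set \<Rightarrow> 'a \<Rightarrow> 'a" where
  "real_part scale XR x = (THE x1. x1 \<in> XR \<and> (\<exists>x2\<in>XR. x = x1 + scale \<i> x2))"

(* A function on [0,2pi] is represented by its extension by 0 to the real line, so that
   distinct elements of the space C([0,2pi],R) are distinct as HOL functions. *)
definition on_interval :: "(real \<Rightarrow> real) \<Rightarrow> real \<Rightarrow> real" where
  "on_interval f = (\<lambda>t. if t \<in> {0..2*pi} then f t else 0)"

definition cont_functions :: "(real \<Rightarrow> real) set" where
  "cont_functions = {f. continuous_on {0..2*pi} f \<and> (\<forall>t. t \<notin> {0..2*pi} \<longrightarrow> f t = 0)}"

definition pointwise_scale :: "real \<Rightarrow> (real \<Rightarrow> real) \<Rightarrow> real \<Rightarrow> real" where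
  "pointwise_scale c f = (\<lambda>t. c * f t)"

lemma on_interval_in_cont_functions:
  "on_interval f \<in> cont_functions \<longleftrightarrow> continuous_on {0..2*pi} f"
proof -
  have "continuous_on {0..2*pi} (on_interval f) \<longleftrightarrow> continuous_on {0..2*pi} f"
    by (rule continuous_on_cong) (auto simp: on_interval_def)
  then show ?thesis
    by (auto simp: cont_functions_def on_interval_def)
qed

lemma vector_space_pointwise_scale: "vector_space pointwise_scale"
  by unfold_locales (auto simp: pointwise_scale_def algebra_simps)

lemma subspace_cont_functions: "module.subspace pointwise_scale cont_functions"
proof -
  interpret vector_space pointwise_scale
    by (rule vector_space_pointwise_scale)
  show ?thesis
    by (rule subspaceI)
       (auto simp: cont_functions_def pointwise_scale_def zero_fun_def plus_fun_def
             intro!: continuous_intros)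
qed

definition monotone_norm :: "((real \<Rightarrow> real) \<Rightarrow> real) \<Rightarrow> bool" where
  "monotone_norm \<nu> \<longleftrightarrow>
     (\<forall>f\<in>cont_functions. \<forall>g\<in>cont_functions.
        (\<forall>t\<in>{0..2*pi}. 0 \<le> f t \<and> f t \<le> g t) \<longrightarrow> \<nu> f \<le> \<nu> g)"

definition shift :: "real \<Rightarrow> (real \<Rightarrow> real) \<Rightarrow> real \<Rightarrow> real" where
  "shift \<psi> f = on_interval (\<lambda>\<phi>. f ((\<phi> + \<psi>) rmod (2*pi)))"

(* shift \<psi> f is discontinuous when f 0 and f (2*pi) differ; the norm is only
   defined on continuous functions, so the identity is required whenever both sides make sense. *)
definition shift_invariant :: "((real \<Rightarrow> real) \<Rightarrow> real) \<Rightarrow> bool" where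
  "shift_invariant \<nu> \<longleftrightarrow>
     (\<forall>f\<in>cont_functions. \<forall>\<psi>. shift \<psi> f \<in> cont_functions \<longrightarrow> \<nu> f = \<nu> (shift \<psi> f))"

definition complexified_norm ::
    "(complex \<Rightarrow> 'a::ab_group_add \<Rightarrow> 'a) \<Rightarrow> 'a set \<Rightarrow> ('a \<Rightarrow> real) \<Rightarrow>
     ((real \<Rightarrow> real) \<Rightarrow> real) \<Rightarrow> 'a \<Rightarrow> real" where
  "complexified_norm scale XR normR \<nu> x =
     \<nu> (on_interval (\<lambda>\<phi>. normR (real_part scale XR (scale (exp (\<i> * complex_of_real \<phi>)) x))))"

end

theory Submission
  imports Defs
begin

text \<open>
  Write \<open>x = a + \<i> b\<close> with \<open>a\<close>, \<open>b\<close> in the real subspace, and attach to \<open>x\<close> its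
  \<^emph>\<open>angular profile\<close>, the function \<open>\<phi> \<mapsto> \<parallel>Re (e\<^sup>i\<^sup>\<phi> x)\<parallel> = \<parallel>cos \<phi> a - sin \<phi> b\<parallel>\<close>; the
  complexified norm is \<open>\<nu>\<close> of this profile. Since \<open>Re\<close> is real-linear, the profile depends
  sublinearly on \<open>x\<close> over the reals, so monotonicity of \<open>\<nu>\<close> gives the triangle inequality, and
  homogeneity of \<open>\<nu>\<close> gives homogeneity for real scalars. Complex homogeneity thus reduces to
  scalars \<open>e\<^sup>i\<^sup>\<psi>\<close>, and multiplying \<open>x\<close> by \<open>e\<^sup>i\<^sup>\<psi>\<close> only rotates the \<open>2\<pi>\<close>-periodic profile by
  \<open>\<psi>\<close>, which \<open>\<nu>\<close> cannot see. The values of the profile at \<open>0\<close> and \<open>\<pi>/2\<close> are \<open>\<parallel>a\<parallel>\<close> and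
  \<open>\<parallel>b\<parallel>\<close>, whence definiteness. Finally, a real \<open>x\<close> has profile \<open>\<bar>cos \<phi>\<bar> \<parallel>x\<parallel>\<close>, so the
  normalization at \<open>\<bar>cos\<bar>\<close> is exactly what makes the new norm extend the old one.
\<close>

section \<open>Complexified normed spaces and their real parts\<close>

locale complexified_normed_space =
  fixes scale :: "complex \<Rightarrow> 'a::ab_group_add \<Rightarrow> 'a"
    and XR :: "'a set"
    and normR :: "'a \<Rightarrow> real"
  assumes complexification: "algebraic_complexification scale XR"
    and norm: "is_norm_on (real_scale scale) XR normR"
begin

sublocale vector_space scale
  using complexification by (simp add: algebraic_complexification_def)

sublocale real: vector_space "real_scale scale"
  by unfold_locales (auto simp: real_scale_def scale_right_distrib scale_left_distrib)

lemma subspace_XR: "real.subspace XR"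
  using complexification by (simp add: algebraic_complexification_def)

lemmas XR_closed [simp, intro] =
  real.subspace_add[OF subspace_XR] real.subspace_diff[OF subspace_XR]
  real.subspace_0[OF subspace_XR] real.subspace_scale[OF subspace_XR]

lemma normR_nonneg: "a \<in> XR \<Longrightarrow> 0 \<le> normR a"
  and normR_eq_0_iff: "a \<in> XR \<Longrightarrow> normR a = 0 \<longleftrightarrow> a = 0"
  and normR_scale: "a \<in> XR \<Longrightarrow> normR (real_scale scale r a) = \<bar>r\<bar> * normR a"
  and normR_triangle: "a \<in> XR \<Longrightarrow> b \<in> XR \<Longrightarrow> normR (a + b) \<le> normR a + normR b"
  using norm unfolding is_norm_on_def real_norm_def by blast+

lemma normR_minus_commute:
  assumes "a \<in> XR" "b \<in> XR"
  shows "normR (a - b) = normR (b - a)"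
  using normR_scale[of "a - b" "-1"] assms by simp

lemma normR_reverse_triangle:
  assumes "a \<in> XR" "b \<in> XR"
  shows "\<bar>normR a - normR b\<bar> \<le> normR (a - b)"
  using normR_triangle[of "a - b" b] normR_triangle[of "b - a" a] normR_minus_commute[of a b] assms
  by (simp add: abs_le_iff)

lemma decomposition:
  obtains a b where "a \<in> XR" "b \<in> XR" "x = a + scale \<i> b"
  using complexification unfolding algebraic_complexification_def by (blast dest: ex1_implies_ex)

lemma decomposition_unique:
  assumes "a \<in> XR" "b \<in> XR" "c \<in> XR" "d \<in> XR" "a + scale \<i> b = c + scale \<i> d"
  shows "a = c"
proof -
  obtain p where "\<And>q. fst q \<in> XR \<Longrightarrow> snd q \<in> XR \<Longrightarrow> a + scale \<i> b = fst q + scale \<i> (snd q) \<Longrightarrow> q = p"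
    using complexification unfolding algebraic_complexification_def by (metis (no_types))
  from this[of "(a, b)"] this[of "(c, d)"] show ?thesis
    using assms by simp
qed

lemma real_part_eq [simp]:
  assumes "a \<in> XR" "b \<in> XR"
  shows "real_part scale XR (a + scale \<i> b) = a"
  unfolding real_part_def
  by (rule the_equality) (use assms decomposition_unique in blast)+

lemma real_part_in_XR: "real_part scale XR x \<in> XR"
  by (rule decomposition[of x]) auto

lemma real_part_add:
  "real_part scale XR (x + y) = real_part scale XR x + real_part scale XR y"
proof -
  obtain a b c d where ab: "a \<in> XR" "b \<in> XR" "x = a + scale \<i> b"
    and cd: "c \<in> XR" "d \<in> XR" "y = c + scale \<i> d"
    using decomposition[of x] decomposition[of y] by metis
  have "x + y = (a + c) + scale \<i> (b + d)"
    by (simp add: ab cd scale_right_distrib algebra_simps)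
  then have "real_part scale XR (x + y) = a + c"
    using ab cd by (metis real_part_eq XR_closed(1))
  then show ?thesis using ab cd by simp
qed

lemma real_part_scale:
  "real_part scale XR (scale (complex_of_real r) x) = real_scale scale r (real_part scale XR x)"
proof -
  obtain a b where ab: "a \<in> XR" "b \<in> XR" "x = a + scale \<i> b"
    using decomposition .
  have "scale (complex_of_real r) x = real_scale scale r a + scale \<i> (real_scale scale r b)"
    by (simp add: ab real_scale_def scale_right_distrib mult.commute)
  then show ?thesis using ab by (metis real_part_eq XR_closed(4))
qed

section \<open>Angular profiles\<close>

text \<open>
  The profile lives on the whole real line, where rotations act as plain translations; it is
  cut down to \<open>[0, 2\<pi>]\<close> only when \<open>\<nu>\<close> is applied.
\<close>
definition profile :: "'a \<Rightarrow> real \<Rightarrow> real" where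
  "profile x \<phi> = normR (real_part scale XR (scale (cis \<phi>) x))"

lemma complexified_norm_eq:
  "complexified_norm scale XR normR \<nu> x = \<nu> (on_interval (profile x))"
  by (simp add: complexified_norm_def profile_def[abs_def] cis_conv_exp)

lemma profile_nonneg: "0 \<le> profile x \<phi>"
  by (simp add: profile_def normR_nonneg real_part_in_XR)

lemma profile_triangle: "profile (x + y) \<phi> \<le> profile x \<phi> + profile y \<phi>"
  by (simp add: profile_def scale_right_distrib real_part_add normR_triangle real_part_in_XR)

lemma profile_scale_real: "profile (scale (complex_of_real r) x) \<phi> = \<bar>r\<bar> * profile x \<phi>"
  unfolding profile_def
  by (metis scale_left_commute real_part_scale normR_scale real_part_in_XR)

lemma profile_scale_cis: "profile (scale (cis \<psi>) x) \<phi> = profile x (\<phi> + \<psi>)"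
  by (simp add: profile_def cis_mult)

lemma profile_rmod: "profile x (\<phi> rmod (2*pi)) = profile x \<phi>"
  by (simp add: profile_def)

lemma profile_decomposed:
  assumes "a \<in> XR" "b \<in> XR"
  shows "profile (a + scale \<i> b) \<phi> = normR (real_scale scale (cos \<phi>) a - real_scale scale (sin \<phi>) b)"
proof -
  have cis: "cis \<phi> = complex_of_real (cos \<phi>) + \<i> * complex_of_real (sin \<phi>)"
    by (simp add: complex_eq_iff)
  have "scale (cis \<phi>) (a + scale \<i> b) =
      (real_scale scale (cos \<phi>) a - real_scale scale (sin \<phi>) b) +
      scale \<i> (real_scale scale (sin \<phi>) a + real_scale scale (cos \<phi>) b)"
    by (simp add: cis real_scale_def scale_right_distrib scale_left_distrib algebra_simps)
  then show ?thesis
    using assms by (simp add: profile_def)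
qed

lemma profile_of_XR:
  assumes "x \<in> XR"
  shows "profile x \<phi> = \<bar>cos \<phi>\<bar> * normR x"
  using profile_decomposed[of x 0 \<phi>] assms by (simp add: normR_scale)

text \<open>
  The reverse triangle inequality transfers the continuity of \<open>cos\<close> and \<open>sin\<close> to the
  profile.
\<close>
lemma isCont_profile: "isCont (profile x) \<phi>"
proof -
  obtain a b where ab: "a \<in> XR" "b \<in> XR" "x = a + scale \<i> b"
    using decomposition .
  let ?u = "\<lambda>t. real_scale scale (cos t) a - real_scale scale (sin t) b"
  let ?bound = "\<lambda>t. \<bar>cos t - cos \<phi>\<bar> * normR a + \<bar>sin \<phi> - sin t\<bar> * normR b"
  \<comment> \<open>the trailing norm and factor \<open>1\<close> give the shape of the comparison rule \<open>tendsto_0_le\<close>\<close>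
  have "norm (profile x t - profile x \<phi>) \<le> norm (?bound t) * 1" for t
  proof -
    have "norm (profile x t - profile x \<phi>) \<le> normR (?u t - ?u \<phi>)"
      using ab normR_reverse_triangle[of "?u t" "?u \<phi>"] by (simp add: profile_decomposed)
    also have "?u t - ?u \<phi> =
        real_scale scale (cos t - cos \<phi>) a + real_scale scale (sin \<phi> - sin t) b"
      by (simp add: real.scale_left_diff_distrib)
    also have "normR \<dots> \<le> ?bound t"
      using ab normR_triangle[of "real_scale scale (cos t - cos \<phi>) a"
          "real_scale scale (sin \<phi> - sin t) b"]
      by (simp add: normR_scale)
    also have "\<dots> \<le> norm (?bound t) * 1" by simp
    finally show ?thesis .
  qed
  moreover have "?bound \<midarrow>\<phi>\<rightarrow> 0"
    by (auto intro!: tendsto_eq_intros)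
  ultimately have "(\<lambda>t. profile x t - profile x \<phi>) \<midarrow>\<phi>\<rightarrow> 0"
    by (blast intro: tendsto_0_le always_eventually)
  then show ?thesis
    by (simp add: isCont_def LIM_zero_iff)
qed

lemma on_interval_profile: "on_interval (profile x) \<in> cont_functions"
  by (simp add: on_interval_in_cont_functions continuous_at_imp_continuous_on isCont_profile)

text \<open>
  The values at \<open>0\<close> and \<open>\<pi>/2\<close>, the norms of the real and the imaginary part, already
  determine whether a vector vanishes.
\<close>
lemma profile_eq_0_iff: "on_interval (profile x) = 0 \<longleftrightarrow> x = 0"
proof
  assume zero: "on_interval (profile x) = 0"
  obtain a b where ab: "a \<in> XR" "b \<in> XR" "x = a + scale \<i> b"
    using decomposition .
  have "profile x 0 = 0" "profile x (pi/2) = 0"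
    using fun_cong[OF zero, of 0] fun_cong[OF zero, of "pi/2"] by (simp_all add: on_interval_def)
  then have "normR a = 0" "normR (0 - b) = 0"
    using ab by (simp_all add: profile_decomposed)
  then show "x = 0"
    using ab normR_minus_commute[of 0 b] by (simp add: normR_eq_0_iff)
next
  assume "x = 0"
  then show "on_interval (profile x) = 0"
    using profile_of_XR[of 0] normR_eq_0_iff[of 0] by (auto simp: on_interval_def)
qed

text \<open>
  Restriction to the interval loses nothing here: evaluating the restricted profile at a
  representative of \<open>\<phi> + \<psi>\<close> modulo \<open>2\<pi>\<close> recovers the periodic profile at \<open>\<phi> + \<psi>\<close>.
  In particular the shift is again continuous, so that shift-invariance applies.
\<close>
lemma shift_profile:
  "shift \<psi> (on_interval (profile x)) = on_interval (profile (scale (cis \<psi>) x))"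
proof -
  have "(\<phi> + \<psi>) rmod (2*pi) \<in> {0..2*pi}" for \<phi>
    using rmod_less[of "2*pi"] rmod_nonneg[of "2*pi"] by (simp add: less_imp_le)
  then have "on_interval (profile x) ((\<phi> + \<psi>) rmod (2*pi)) = profile (scale (cis \<psi>) x) \<phi>" for \<phi>
    by (simp add: on_interval_def profile_rmod profile_scale_cis del: atLeastAtMost_iff)
  then show ?thesis by (simp add: shift_def)
qed

section \<open>The complexified norm\<close>

context
  fixes \<nu> :: "(real \<Rightarrow> real) \<Rightarrow> real"
  assumes \<nu>_norm: "is_norm_on pointwise_scale cont_functions \<nu>"
begin

lemma complexified_norm_scale_real:
  "complexified_norm scale XR normR \<nu> (scale (complex_of_real r) x) =
     \<bar>r\<bar> * complexified_norm scale XR normR \<nu> x"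
proof -
  have "on_interval (profile (scale (complex_of_real r) x)) =
      pointwise_scale \<bar>r\<bar> (on_interval (profile x))"
    by (auto simp: on_interval_def pointwise_scale_def profile_scale_real)
  then show ?thesis
    using \<nu>_norm on_interval_profile[of x] by (simp add: complexified_norm_eq is_norm_on_def)
qed

text \<open>
  In the polar form \<open>c = \<bar>c\<bar> e\<^sup>i\<^sup>\<psi>\<close> the modulus is a real scalar, and the phase merely shifts
  the profile.
\<close>
lemma complexified_norm_scale:
  assumes "shift_invariant \<nu>"
  shows "complexified_norm scale XR normR \<nu> (scale c x) =
     cmod c * complexified_norm scale XR normR \<nu> x"
proof -
  have "complexified_norm scale XR normR \<nu> (scale (cis (Arg c)) x) =
      complexified_norm scale XR normR \<nu> x"
    using assms on_interval_profile[of x] on_interval_profile[of "scale (cis (Arg c)) x"]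
    by (simp add: shift_invariant_def complexified_norm_eq flip: shift_profile)
  moreover have "scale c x = scale (complex_of_real (cmod c)) (scale (cis (Arg c)) x)"
    by (metis rcis_cmod_Arg rcis_def scale_scale)
  ultimately show ?thesis
    by (metis complexified_norm_scale_real abs_norm_cancel)
qed

lemma complexified_norm_triangle:
  assumes "monotone_norm \<nu>"
  shows "complexified_norm scale XR normR \<nu> (x + y) \<le>
     complexified_norm scale XR normR \<nu> x + complexified_norm scale XR normR \<nu> y"
proof -
  let ?f = "\<lambda>x. on_interval (profile x)"
  have cont: "?f x + ?f y \<in> cont_functions"
    using module.subspace_add[OF _ subspace_cont_functions on_interval_profile on_interval_profile]
      vector_space_pointwise_scale by (simp add: module_iff_vector_space)
  have "\<nu> (?f (x + y)) \<le> \<nu> (?f x + ?f y)"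
    using assms cont on_interval_profile[of "x + y"] profile_triangle[of x y]
      profile_nonneg[of "x + y"]
    unfolding monotone_norm_def by (auto simp: on_interval_def)
  also have "\<dots> \<le> \<nu> (?f x) + \<nu> (?f y)"
    using \<nu>_norm on_interval_profile by (simp add: is_norm_on_def)
  finally show ?thesis by (simp add: complexified_norm_eq)
qed

lemma is_norm_complexified_norm:
  assumes "monotone_norm \<nu>" "shift_invariant \<nu>"
  shows "is_norm_on scale UNIV (complexified_norm scale XR normR \<nu>)"
proof -
  have "0 \<le> complexified_norm scale XR normR \<nu> x" for x
    using \<nu>_norm on_interval_profile by (simp add: complexified_norm_eq is_norm_on_def)
  moreover have "complexified_norm scale XR normR \<nu> x = 0 \<longleftrightarrow> x = 0" for x
    using \<nu>_norm on_interval_profile by (simp add: complexified_norm_eq is_norm_on_def profile_eq_0_iff)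
  ultimately show ?thesis
    using assms by (simp add: is_norm_on_def complexified_norm_scale complexified_norm_triangle)
qed

lemma complexified_norm_of_XR:
  assumes "x \<in> XR"
  shows "complexified_norm scale XR normR \<nu> x = \<nu> (on_interval (\<lambda>\<phi>. \<bar>cos \<phi>\<bar>)) * normR x"
proof -
  have "on_interval (profile x) = pointwise_scale (normR x) (on_interval (\<lambda>\<phi>. \<bar>cos \<phi>\<bar>))"
    using assms by (auto simp: on_interval_def pointwise_scale_def profile_of_XR)
  moreover have "on_interval (\<lambda>\<phi>. \<bar>cos \<phi>\<bar>) \<in> cont_functions"
    by (auto simp: on_interval_in_cont_functions intro!: continuous_intros)
  ultimately show ?thesis
    using \<nu>_norm assms by (simp add: complexified_norm_eq is_norm_on_def normR_nonneg)
qed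

end

end

theorem proposition5p1:
  fixes scale :: "complex \<Rightarrow> 'a::ab_group_add \<Rightarrow> 'a"
    and XR :: "'a set"
    and normR :: "'a \<Rightarrow> real"
    and \<nu> :: "(real \<Rightarrow> real) \<Rightarrow> real"
  assumes "algebraic_complexification scale XR"
    and "is_norm_on (real_scale scale) XR normR"
    and "is_norm_on pointwise_scale cont_functions \<nu>"
    and "monotone_norm \<nu>"
    and "shift_invariant \<nu>"
  shows "is_norm_on scale UNIV (complexified_norm scale XR normR \<nu>) \<and>
         (\<nu> (on_interval (\<lambda>\<phi>. \<bar>cos \<phi>\<bar>)) = 1 \<longrightarrow>
            (\<forall>x\<in>XR. complexified_norm scale XR normR \<nu> x = normR x))"
proof -
  interpret complexified_normed_space scale XR normR
    by unfold_locales (fact assms)+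
  show ?thesis
    using assms(3-5) by (simp add: is_norm_complexified_norm complexified_norm_of_XR)
qed

end
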